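(* Suppose the graph $(\mathcal N,\mathcal E)$ is radial and the point $(s,\mathfrak s,V,I,S,S',r,A)$ is feasible for RBOPF. Then the point $(s,\mathfrak s,v,i,i',r,A)$, where $v$, $i$ and $i'$ are computed via the Retrieval Algorithm, is feasible for BOPF. (RBOPF, BOPF and the Retrieval Algorithm are defined in the context.)
   Context: **Notation.** $\bar{x}$ denotes the conjugate transpose of a vector or matrix $x$, and $x^*$ the entrywise complex conjugate. For a vector $x$, $\mathrm{diag}(x)$ is the diagonal matrix with diagonal $x$; for a square matrix $X$, $\mathrm{diag}(X)$ is the vector of its diagonal entries. Inequalities and absolute values of vectors are entrywise. $\mathbf O$ is a zero matrix, $\succeq$ is the positive semidefinite order on Hermitian matrices, $\mathrm{tr}$ is the trace. Vectors in $\mathbb C^3$ are indexed by the phases $\Omega=\{a,b,c\}$. **Network.** A three-phase distribution network is modeled by a graph $(\mathcal N,\mathcal E)$ with buses $\mathcal N=\{0,1,\dots,N\}$ (bus $0$ is the substation) and edges $\mathcal E\subseteq\mathcal N\times\mathcal N$; write $n\to m$ for $(n,m)\in\mathcal E$. $\mathcal E=\mathcal E_{\mathrm t}\cup\mathcal E_{\mathrm r}$ is a partition: an ordered pair $(n,m)$ belongs to $\mathcal E_{\mathrm t}$ when $n<m$ and buses $n$ and $m$ are connected via a transmission line or a transformer; $(n,m)$ belongs to $\mathcal E_{\mathrm r}$ when $n$ and $m$ are respectively the primary and the secondary of a step-voltage regulator (SVR). For $m\in\mathcal N$ let $\mathcal N_m^{\mathrm p}=\{n:(n,m)\in\mathcal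 E_{\mathrm r}\}$. "Radial" has its usual meaning for power networks, i.e. the network graph is a tree. Given data: series impedances $Z_{nm}\in\mathbb C^{3\times3}$ for $(n,m)\in\mathcal E_{\mathrm t}$; shunt admittances $Y_m\in\mathbb C^{3\times 3}$ for $m\in\mathcal N$; the fixed slack-bus voltage $\mathrm v_0\in\mathbb C^3$; voltage magnitude limits $v_{\min}$, $v_{\max}$; a set $\mathcal S$ of allowed constant-power injections $\mathfrak s=\{\mathfrak s_m\}_{m\in\mathcal N}$, $\mathfrak s_m\in\mathbb C^3$. **SVR types.** SVRs are ideal (negligible series impedance) with continuous turns ratios. Each $(n,m)\in\mathcal E_{\mathrm r}$ has one of three types (wye, closed-delta, open-delta), with real turns ratios $r_{nm}=(r^a_{nm},r^b_{nm},r^c_{nm})$ and a voltage gain matrix $A_{nm}$. **BOPF.** Variables: $s=\{s_m\},\mathfrak s=\{\mathfrak s_m\},v=\{v_m\}$ ($m\in\mathcal N$), $i=\{i_{nm}\}_{\mathcal E}$, $i'=\{i'_{nm}\}_{\mathcal E_{\mathrm r}}$ (all entries in $\mathbb C^3$), $r=\{r_{nm}\}_{\mathcal E_{\mathrm r}}$, $A=\{A_{nm}\}_{\mathcal E_{\mathrm r}}$. Constraints (the objective is irrelevant for feasibility): (B1) $v_m=v_n-Z_{nm}i_{nm}$ for $(n,m)\in\mathcal E_{\mathrm t}$; (B2) $v_n=A_{nm}v_m$ and $i_{nm}=\bar A_{nm}^{-1}i'_{nm}$ for $(n,m)\in\mathcal E_{\mathrm r}$; (B3) for $(n,m)\in\mathcal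 E_{\mathrm r}$, $0.9\le r_{nm}\le1.1$ entrywise (with $r_{nm}^b=1$ fixed for open-delta), and $A_{nm}$ is determined by $r_{nm}$ according to the type of $(n,m)$ (subscripts $nm$ suppressed in the matrices): wye: $A_{nm}=\mathrm{diag}(r_{nm})$; closed-delta: $A_{nm}=\begin{bmatrix} r^a&1-r^a&0\\0&r^b&1-r^b\\1-r^c&0&r^c\end{bmatrix}$; open-delta: $A_{nm}=\begin{bmatrix} r^a&1-r^a&0\\0&1&0\\0&1-r^c&r^c\end{bmatrix}$; (B4) $s_m=\mathfrak s_m-\mathrm{diag}(v_m\bar v_m\bar Y_m)$, $m\in\mathcal N$; (B5) $s_m=\sum_{k:m\to k}\mathrm{diag}(v_m\bar i_{mk})-\sum_{n:n\to m,\,n\in\mathcal N_m^{\mathrm p}}\mathrm{diag}(v_m\bar i'_{nm})-\sum_{n:n\to m,\,n\notin\mathcal N_m^{\mathrm p}}\mathrm{diag}(v_m\bar i_{nm})$, $m\in\mathcal N$; (B6) $v_0=\mathrm v_0$; $v_{\min}\le|v_n|\le v_{\max}$ for $n\in\mathcal N$; $\mathfrak s\in\mathcal S$. **RBOPF.** Variables: $s=\{s_m\}_{\mathcal N}$, $\mathfrak s=\{\mathfrak s_m\}_{\mathcal N}$ (entries in $\mathbb C^3$), $r=\{r_{nm}\}_{\mathcal E_{\mathrm r}}$, $A=\{A_{nm}\}_{\mathcal E_{\mathrm r}}$, and complex $3\times3$ matrices $V=\{V_m\}_{\mathcal N}$, $I=\{I_{nm}\}_{\mathcal E}$, $S=\{S_{nm}\}_{\mathcal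 E}$, $S'=\{S'_{nm}\}_{\mathcal E_{\mathrm r}}$. Constraints: (B3), $\mathfrak s\in\mathcal S$, and: (R1) $V_m=V_n+Z_{nm}I_{nm}\bar Z_{nm}-(S_{nm}\bar Z_{nm}+Z_{nm}\bar S_{nm})$, $(n,m)\in\mathcal E_{\mathrm t}$; (R2) $V_n=A_{nm}V_m\bar A_{nm}$, $(n,m)\in\mathcal E_{\mathrm r}$; (R3) $\mathrm{diag}(A_{nm}^{-1}S_{nm}A_{nm})=\mathrm{diag}(S'_{nm})$, $(n,m)\in\mathcal E_{\mathrm r}$; (R4) $s_m=\mathfrak s_m-\mathrm{diag}(V_m\bar Y_m)$, $m\in\mathcal N$; (R5) $s_m=\sum_{k:m\to k}\mathrm{diag}(S_{mk})-\sum_{n:n\to m,\,n\in\mathcal N_m^{\mathrm p}}\mathrm{diag}(S'_{nm})-\sum_{n:n\to m,\,n\notin\mathcal N_m^{\mathrm p}}\mathrm{diag}(S_{nm}-Z_{nm}I_{nm})$, $m\in\mathcal N$; (R6) $V_0=\mathrm v_0\bar{\mathrm v}_0$; $(v_{\min})^2\le\mathrm{diag}(V_n)\le (v_{\max})^2$, $n\in\mathcal N$; (R7) $\begin{bmatrix}V_n&S_{nm}\\\bar S_{nm}&I_{nm}\end{bmatrix}\succeq\mathbf O$ and this matrix has rank $1$, $(n,m)\in\mathcal E$. **Retrieval Algorithm** (retrieves $v,i,i'$ from $V,I,S,S'$, also using $A$). Initialize $\mathcal N_{\mathrm{visit}}=\{0\}$ and $v_0=\mathrm v_0$. While $\mathcal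 N_{\mathrm{visit}}\ne\mathcal N$: find $(n,m)\in\mathcal E$ with $n\in\mathcal N_{\mathrm{visit}}$, $m\notin\mathcal N_{\mathrm{visit}}$; set $i_{nm}:=\frac{1}{\mathrm{tr}(V_n)}\bar S_{nm}v_n$; if $(n,m)\in\mathcal E_{\mathrm r}$, set $v_m:=A_{nm}^{-1}v_n$ and $i'_{nm}:=\mathrm{diag}(v_m^* )^{-1}\mathrm{diag}(\bar S'_{nm})$; otherwise set $v_m:=v_n-Z_{nm}i_{nm}$; then add $m$ to $\mathcal N_{\mathrm{visit}}$. *)

theory Defs
  imports "HOL-Analysis.Analysis"
begin

datatype phase = PhA | PhB | PhC

lemma UNIV_phase: "UNIV = {PhA, PhB, PhC}"
  by (auto intro: phase.exhaust)

instance phase :: finite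
  by standard (simp add: UNIV_phase)

type_synonym cvec = "complex ^ phase"
type_synonym cmat = "complex ^ phase ^ phase"

definition phase_vec :: "'a \<Rightarrow> 'a \<Rightarrow> 'a \<Rightarrow> 'a ^ phase" where
  "phase_vec x y z = (\<chi> p. case p of PhA \<Rightarrow> x | PhB \<Rightarrow> y | PhC \<Rightarrow> z)"

definition ctrans :: "complex ^ 'n ^ 'm \<Rightarrow> complex ^ 'm ^ 'n" where
  "ctrans X = (\<chi> i j. cnj (X $ j $ i))"

definition cnj_vec :: "complex ^ 'n \<Rightarrow> complex ^ 'n" where
  "cnj_vec x = (\<chi> i. cnj (x $ i))"

definition outer :: "complex ^ 'm \<Rightarrow> complex ^ 'n \<Rightarrow> complex ^ 'n ^ 'm" where
  "outer x y = (\<chi> i j. x $ i * cnj (y $ j))"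

definition diag_mat :: "complex ^ 'n \<Rightarrow> complex ^ 'n ^ 'n" where
  "diag_mat x = (\<chi> i j. if i = j then x $ i else 0)"

definition diag_vec :: "complex ^ 'n ^ 'n \<Rightarrow> complex ^ 'n" where
  "diag_vec X = (\<chi> i. X $ i $ i)"

definition psd :: "complex ^ 'n ^ 'n \<Rightarrow> bool" where
  "psd X \<longleftrightarrow> ctrans X = X \<and>
     (\<forall>x. 0 \<le> Re (\<Sum>i\<in>UNIV. \<Sum>j\<in>UNIV. cnj (x $ i) * X $ i $ j * x $ j))"

definition block_mat ::
  "'a ^ 'n ^ 'm \<Rightarrow> 'a ^ 'l ^ 'm \<Rightarrow> 'a ^ 'n ^ 'k \<Rightarrow> 'a ^ 'l ^ 'k \<Rightarrow> 'a ^ ('n + 'l) ^ ('m + 'k)" where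
  "block_mat P Q R T = (\<chi> i j. case i of
       Inl a \<Rightarrow> (case j of Inl b \<Rightarrow> P $ a $ b | Inr b \<Rightarrow> Q $ a $ b)
     | Inr a \<Rightarrow> (case j of Inl b \<Rightarrow> R $ a $ b | Inr b \<Rightarrow> T $ a $ b))"

datatype svr_type = Wye | Closed_Delta | Open_Delta

text \<open>The buses are \<open>0, \<dots>, last_bus net\<close>, with the substation at bus 0. An SVR edge
  \<open>(n, m)\<close> has primary \<open>n\<close> and secondary \<open>m\<close>. Values of the families at indices that are not
  buses or edges of the relevant kind are irrelevant. The magnitude limits may differ between
  phases; a scalar limit is a constant vector.\<close>

record network =
  last_bus :: nat
  lines :: "(nat \<times> nat) set"
  svrs :: "(nat \<times> nat) set"
  svr_kind :: "nat \<times> nat \<Rightarrow> svr_type"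
  impedance :: "nat \<times> nat \<Rightarrow> cmat"
  shunt :: "nat \<Rightarrow> cmat"
  slack :: cvec
  vmin :: "real ^ phase"
  vmax :: "real ^ phase"
  injections :: "(nat \<Rightarrow> cvec) set"

definition buses :: "network \<Rightarrow> nat set" where
  "buses net = {0..last_bus net}"

definition edges :: "network \<Rightarrow> (nat \<times> nat) set" where
  "edges net = lines net \<union> svrs net"

definition primaries :: "network \<Rightarrow> nat \<Rightarrow> nat set" where
  "primaries net m = {n. (n, m) \<in> svrs net}"

definition wf_network :: "network \<Rightarrow> bool" where
  "wf_network net \<longleftrightarrow>
     edges net \<subseteq> buses net \<times> buses net \<and>
     lines net \<inter> svrs net = {} \<and>
     (\<forall>(n, m)\<in>lines net. n < m) \<and>
     (\<forall>p. 0 \<le> vmin net $ p \<and> 0 \<le> vmax net $ p)"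

text \<open>Edge directions are disregarded in the next three definitions: each pair in \<open>E\<close> is one
  undirected edge, so a self-loop and a pair of antiparallel edges are cycles (with one and two
  vertices).\<close>

definition graph_connected :: "'v set \<Rightarrow> ('v \<times> 'v) set \<Rightarrow> bool" where
  "graph_connected N E \<longleftrightarrow> (\<forall>u\<in>N. \<forall>w\<in>N. (u, w) \<in> (E \<union> E\<inverse>)\<^sup>*)"

definition graph_cycle :: "('v \<times> 'v) set \<Rightarrow> 'v list \<Rightarrow> ('v \<times> 'v) list \<Rightarrow> bool" where
  "graph_cycle E us es \<longleftrightarrow>
     us \<noteq> [] \<and> length es = length us \<and> distinct us \<and> distinct es \<and> set es \<subseteq> E \<and>
     (\<forall>k<length us. let u = us ! k; w = us ! (Suc k mod length us)
        in es ! k = (u, w) \<or> es ! k = (w, u))"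

definition graph_tree :: "'v set \<Rightarrow> ('v \<times> 'v) set \<Rightarrow> bool" where
  "graph_tree N E \<longleftrightarrow> graph_connected N E \<and> (\<nexists>us es. graph_cycle E us es)"

definition radial :: "network \<Rightarrow> bool" where
  "radial net \<longleftrightarrow> graph_tree (buses net) (edges net)"

definition outward :: "network \<Rightarrow> bool" where
  "outward net \<longleftrightarrow> (\<forall>m\<in>buses net. (0, m) \<in> (edges net)\<^sup>*)"

fun gain :: "svr_type \<Rightarrow> real ^ phase \<Rightarrow> cmat" where
  "gain Wye r = diag_mat (\<chi> p. of_real (r $ p))"
| "gain Closed_Delta r =
     (let ra = of_real (r $ PhA); rb = of_real (r $ PhB); rc = of_real (r $ PhC)
      in phase_vec (phase_vec ra       (1 - ra) 0)
                   (phase_vec 0        rb       (1 - rb))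
                   (phase_vec (1 - rc) 0        rc))"
| "gain Open_Delta r =
     (let ra = of_real (r $ PhA); rc = of_real (r $ PhC)
      in phase_vec (phase_vec ra (1 - ra) 0)
                   (phase_vec 0  1        0)
                   (phase_vec 0  (1 - rc) rc))"

definition svr_constraints ::
  "network \<Rightarrow> (nat \<times> nat \<Rightarrow> real ^ phase) \<Rightarrow> (nat \<times> nat \<Rightarrow> cmat) \<Rightarrow> bool" where
  "svr_constraints net r A \<longleftrightarrow>
     (\<forall>e\<in>svrs net.
        (\<forall>p. 0.9 \<le> r e $ p \<and> r e $ p \<le> 1.1) \<and>
        (svr_kind net e = Open_Delta \<longrightarrow> r e $ PhB = 1) \<and>
        A e = gain (svr_kind net e) (r e))"

definition bopf_feasible ::
  "network \<Rightarrow> (nat \<Rightarrow> cvec) \<Rightarrow> (nat \<Rightarrow> cvec) \<Rightarrow> (nat \<Rightarrow> cvec) \<Rightarrow>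
   (nat \<times> nat \<Rightarrow> cvec) \<Rightarrow> (nat \<times> nat \<Rightarrow> cvec) \<Rightarrow>
   (nat \<times> nat \<Rightarrow> real ^ phase) \<Rightarrow> (nat \<times> nat \<Rightarrow> cmat) \<Rightarrow> bool" where
  "bopf_feasible net s sinj v i i' r A \<longleftrightarrow>
     (\<forall>(n, m)\<in>lines net. v m = v n - impedance net (n, m) *v i (n, m)) \<and>
     (\<forall>(n, m)\<in>svrs net.
        v n = A (n, m) *v v m \<and>
        i (n, m) = matrix_inv (ctrans (A (n, m))) *v i' (n, m)) \<and>
     svr_constraints net r A \<and>
     (\<forall>m\<in>buses net. s m = sinj m - diag_vec (outer (v m) (v m) ** ctrans (shunt net m))) \<and>
     (\<forall>m\<in>buses net. s m =
        (\<Sum>k | (m, k) \<in> edges net. diag_vec (outer (v m) (i (m, k))))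
        - (\<Sum>n | (n, m) \<in> edges net \<and> n \<in> primaries net m. diag_vec (outer (v m) (i' (n, m))))
        - (\<Sum>n | (n, m) \<in> edges net \<and> n \<notin> primaries net m. diag_vec (outer (v m) (i (n, m))))) \<and>
     v 0 = slack net \<and>
     (\<forall>n\<in>buses net. \<forall>p. vmin net $ p \<le> cmod (v n $ p) \<and> cmod (v n $ p) \<le> vmax net $ p) \<and>
     (\<exists>t\<in>injections net. \<forall>m\<in>buses net. t m = sinj m)"

text \<open>The diagonal of each \<open>V n\<close> is real for every point satisfying the other constraints, so
  its bounds are stated for the real part.\<close>

definition rbopf_feasible ::
  "network \<Rightarrow> (nat \<Rightarrow> cvec) \<Rightarrow> (nat \<Rightarrow> cvec) \<Rightarrow> (nat \<Rightarrow> cmat) \<Rightarrow>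
   (nat \<times> nat \<Rightarrow> cmat) \<Rightarrow> (nat \<times> nat \<Rightarrow> cmat) \<Rightarrow> (nat \<times> nat \<Rightarrow> cmat) \<Rightarrow>
   (nat \<times> nat \<Rightarrow> real ^ phase) \<Rightarrow> (nat \<times> nat \<Rightarrow> cmat) \<Rightarrow> bool" where
  "rbopf_feasible net s sinj V I S S' r A \<longleftrightarrow>
     svr_constraints net r A \<and>
     (\<exists>t\<in>injections net. \<forall>m\<in>buses net. t m = sinj m) \<and>
     (\<forall>(n, m)\<in>lines net. let Z = impedance net (n, m) in
        V m = V n + Z ** I (n, m) ** ctrans Z
                - (S (n, m) ** ctrans Z + Z ** ctrans (S (n, m)))) \<and>
     (\<forall>(n, m)\<in>svrs net. V n = A (n, m) ** V m ** ctrans (A (n, m))) \<and>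
     (\<forall>e\<in>svrs net. diag_vec (matrix_inv (A e) ** S e ** A e) = diag_vec (S' e)) \<and>
     (\<forall>m\<in>buses net. s m = sinj m - diag_vec (V m ** ctrans (shunt net m))) \<and>
     (\<forall>m\<in>buses net. s m =
        (\<Sum>k | (m, k) \<in> edges net. diag_vec (S (m, k)))
        - (\<Sum>n | (n, m) \<in> edges net \<and> n \<in> primaries net m. diag_vec (S' (n, m)))
        - (\<Sum>n | (n, m) \<in> edges net \<and> n \<notin> primaries net m.
             diag_vec (S (n, m) - impedance net (n, m) ** I (n, m)))) \<and>
     V 0 = outer (slack net) (slack net) \<and>
     (\<forall>n\<in>buses net. \<forall>p. (vmin net $ p)\<^sup>2 \<le> Re (diag_vec (V n) $ p) \<and>
                         Re (diag_vec (V n) $ p) \<le> (vmax net $ p)\<^sup>2) \<and>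
     (\<forall>(n, m)\<in>edges net.
        let X = block_mat (V n) (S (n, m)) (ctrans (S (n, m))) (I (n, m))
        in psd X \<and> rank X = 1)"

text \<open>A state consists of the visited buses and the current \<open>v\<close>, \<open>i\<close>, \<open>i'\<close>; entries not yet
  assigned are arbitrary. One step is one pass through the loop body, for any admissible choice of
  the edge \<open>(n, m)\<close>. A pass is possible only if the divisor \<open>trace (V n)\<close> is nonzero and the
  matrices to be inverted are invertible.\<close>

type_synonym retrieval_state =
  "nat set \<times> (nat \<Rightarrow> cvec) \<times> (nat \<times> nat \<Rightarrow> cvec) \<times> (nat \<times> nat \<Rightarrow> cvec)"

inductive retrieval_step ::
  "network \<Rightarrow> (nat \<Rightarrow> cmat) \<Rightarrow> (nat \<times> nat \<Rightarrow> cmat) \<Rightarrow> (nat \<times> nat \<Rightarrow> cmat) \<Rightarrow>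
   (nat \<times> nat \<Rightarrow> cmat) \<Rightarrow> retrieval_state \<Rightarrow> retrieval_state \<Rightarrow> bool"
  for net V S S' A where
  svr: "retrieval_step net V S S' A (W, v, i, i')
          (insert m W, v(m := vm), i((n, m) := inm), i'((n, m) := inm'))"
    if "W \<noteq> buses net" "(n, m) \<in> edges net" "n \<in> W" "m \<notin> W" "(n, m) \<in> svrs net"
      "trace (V n) \<noteq> 0" "inm = (1 / trace (V n)) *s (ctrans (S (n, m)) *v v n)"
      "invertible (A (n, m))" "vm = matrix_inv (A (n, m)) *v v n"
      "invertible (diag_mat (cnj_vec vm))"
      "inm' = matrix_inv (diag_mat (cnj_vec vm)) *v diag_vec (ctrans (S' (n, m)))"
| line: "retrieval_step net V S S' A (W, v, i, i')
          (insert m W, v(m := vm), i((n, m) := inm), i')"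
    if "W \<noteq> buses net" "(n, m) \<in> edges net" "n \<in> W" "m \<notin> W" "(n, m) \<notin> svrs net"
      "trace (V n) \<noteq> 0" "inm = (1 / trace (V n)) *s (ctrans (S (n, m)) *v v n)"
      "vm = v n - impedance net (n, m) *v inm"

definition retrieval_run ::
  "network \<Rightarrow> (nat \<Rightarrow> cmat) \<Rightarrow> (nat \<times> nat \<Rightarrow> cmat) \<Rightarrow> (nat \<times> nat \<Rightarrow> cmat) \<Rightarrow>
   (nat \<times> nat \<Rightarrow> cmat) \<Rightarrow> retrieval_state \<Rightarrow> bool" where
  "retrieval_run net V S S' A \<sigma> \<longleftrightarrow>
     (\<exists>v i i'. v 0 = slack net \<and> (retrieval_step net V S S' A)\<^sup>*\<^sup>* ({0}, v, i, i') \<sigma>)"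

definition retrieval_output ::
  "network \<Rightarrow> (nat \<Rightarrow> cmat) \<Rightarrow> (nat \<times> nat \<Rightarrow> cmat) \<Rightarrow> (nat \<times> nat \<Rightarrow> cmat) \<Rightarrow>
   (nat \<times> nat \<Rightarrow> cmat) \<Rightarrow> (nat \<Rightarrow> cvec) \<Rightarrow> (nat \<times> nat \<Rightarrow> cvec) \<Rightarrow> (nat \<times> nat \<Rightarrow> cvec) \<Rightarrow> bool" where
  "retrieval_output net V S S' A v i i' \<longleftrightarrow> retrieval_run net V S S' A (buses net, v, i, i')"

end

theory Submission
  imports Defs
begin

text \<open>Write \<open>x\<^sup>H\<close> for the conjugate transpose. If \<open>V n = v n (v n)\<^sup>H\<close> has nonzero trace, the
  vanishing 2-by-2 minors of the rank-one block matrix show that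
  \<open>i = S\<^sup>H (v n) / tr (V n)\<close> satisfies \<open>S = v n i\<^sup>H\<close> and \<open>I = i i\<^sup>H\<close>. Substituting these into the RBOPF constraints of the edge gives
  \<open>V m = v m (v m)\<^sup>H\<close> together with the BOPF constraints of the edge, so they hold for every
  traversed edge by induction along the run. The traversed edges connect all buses when the run
  ends; in a tree, a connected spanning subgraph contains every edge, so no constraint is missed.\<close>

section \<open>Simple paths and spanning subgraphs of trees\<close>

text \<open>A walk is extended vertex by vertex. If the new vertex already lies on the path built so
  far, the path is cut off there; otherwise the vertex is appended.\<close>

lemma rtrancl_simple_path:
  assumes "(u, w) \<in> R\<^sup>*"
  obtains us where "us \<noteq> []" "hd us = u" "last us = w" "distinct us"
    "successively (\<lambda>x y. (x, y) \<in> R) us"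
proof -
  have "\<exists>us. us \<noteq> [] \<and> hd us = u \<and> last us = w \<and> distinct us \<and> successively (\<lambda>x y. (x, y) \<in> R) us"
    using assms
  proof (induction rule: rtrancl_induct)
    case base
    show ?case by (intro exI[of _ "[u]"]) simp
  next
    case (step y z)
    then obtain us where us: "us \<noteq> []" "hd us = u" "last us = y" "distinct us"
      "successively (\<lambda>x y. (x, y) \<in> R) us"
      by blast
    show ?case
    proof (cases "z \<in> set us")
      case True
      then obtain ys zs where eq: "us = ys @ z # zs"
        by (meson split_list)
      \<comment> \<open>Reassociating the append puts the cut right after \<open>z\<close>.\<close>
      have "successively (\<lambda>x y. (x, y) \<in> R) ((ys @ [z]) @ zs)"
        using us(5) by (simp add: eq)
      then have "successively (\<lambda>x y. (x, y) \<in> R) (ys @ [z])"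
        unfolding successively_append_iff by blast
      with us(2,4) eq show ?thesis
        by (intro exI[of _ "ys @ [z]"]) (cases ys; auto)
    next
      case False
      with us step.hyps show ?thesis
        by (intro exI[of _ "us @ [z]"]) (auto simp: successively_append_iff)
    qed
  qed
  with that show thesis by blast
qed

text \<open>An edge \<open>(p, q)\<close> of \<open>E\<close> outside \<open>U\<close> would close a
  cycle with a simple path from \<open>p\<close> to \<open>q\<close> in \<open>U\<close>. Self-loops
  and antiparallel edges are covered as paths with zero edges and one edge.\<close>

lemma graph_tree_spanning_subgraph:
  assumes "graph_tree N E" "E \<subseteq> N \<times> N" "U \<subseteq> E" "graph_connected N U"
  shows "U = E"
proof (rule ccontr)
  assume "U \<noteq> E"
  with \<open>U \<subseteq> E\<close> obtain p q where pq: "(p, q) \<in> E" "(p, q) \<notin> U"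
    by auto
  with assms have "(p, q) \<in> (U \<union> U\<inverse>)\<^sup>*"
    unfolding graph_connected_def by blast
  then obtain us where us: "us \<noteq> []" "hd us = p" "last us = q" "distinct us"
    "successively (\<lambda>x y. (x, y) \<in> U \<union> U\<inverse>) us"
    by (rule rtrancl_simple_path)
  \<comment> \<open>\<open>l\<close> counts the edges of the path. Edge \<open>f k\<close> of the
    cycle joins the vertices \<open>k\<close> and \<open>Suc k\<close> for \<open>k < l\<close>, and
    \<open>(p, q)\<close> is placed at index \<open>l\<close>.\<close>
  define l where "l = length us - 1"
  have len: "length us = Suc l"
    using us(1) by (simp add: l_def)
  have "\<exists>e\<in>U. e = (us ! k, us ! Suc k) \<or> e = (us ! Suc k, us ! k)" if "k < l" for k
    using us(5) that len by (auto simp: successively_conv_nth)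
  then obtain f where f: "\<And>k. k < l \<Longrightarrow> f k \<in> U"
    "\<And>k. k < l \<Longrightarrow> f k = (us ! k, us ! Suc k) \<or> f k = (us ! Suc k, us ! k)"
    by metis
  \<comment> \<open>Equal edges have equal end points. As the vertices are distinct, the same
    orientation gives \<open>j = k\<close>, and opposite orientations give \<open>j = Suc k\<close>
    and \<open>k = Suc j\<close>, which is absurd.\<close>
  have "inj_on f {..<l}"
  proof (rule inj_onI)
    fix j k assume jk: "j \<in> {..<l}" "k \<in> {..<l}" "f j = f k"
    then have "us ! j = us ! k \<or> us ! j = us ! Suc k \<and> us ! Suc j = us ! k"
      using f(2)[of j] f(2)[of k] by auto
    then have "j = k \<or> j = Suc k \<and> Suc j = k"
      using jk us(4) len by (auto simp: nth_eq_iff_index_eq)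
    then show "j = k" by auto
  qed
  then have "distinct (map f [0..<l] @ [(p, q)])"
    using f(1) pq(2) by (auto simp: distinct_map lessThan_atLeast0)
  moreover have "us ! 0 = p" "us ! l = q"
    using us by (auto simp: hd_conv_nth last_conv_nth l_def)
  \<comment> \<open>At \<open>k = l\<close> the index \<open>Suc l mod Suc l\<close> is 0, so
    \<open>(p, q)\<close> leads back from \<open>us ! l = q\<close> to \<open>us ! 0 = p\<close>,
    traversed backwards.\<close>
  moreover from this have "\<exists>e. (map f [0..<l] @ [(p, q)]) ! k = e \<and>
      (e = (us ! k, us ! (Suc k mod Suc l)) \<or> e = (us ! (Suc k mod Suc l), us ! k))"
    if "k < Suc l" for k
    using f(2)[of k] that by (cases "k = l") (auto simp: nth_append)
  ultimately have "graph_cycle E us (map f [0..<l] @ [(p, q)])"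
    unfolding graph_cycle_def Let_def using us(1,4) f(1) pq assms(3)
    by (auto simp: len)
  with assms(1) show False
    by (auto simp: graph_tree_def)
qed

section \<open>Conjugate transposes, outer products and inverse matrices\<close>

lemma ctrans_ctrans [simp]: "ctrans (ctrans M) = M"
  by (simp add: ctrans_def vec_eq_iff)

lemma ctrans_mult: "ctrans (M ** N) = ctrans N ** ctrans M"
  by (simp add: ctrans_def matrix_matrix_mult_def vec_eq_iff mult.commute)

lemma ctrans_mat_1 [simp]: "ctrans (mat 1) = mat 1"
  by (auto simp: ctrans_def mat_def vec_eq_iff)

lemma ctrans_outer: "ctrans (outer x y) = outer y x"
  by (simp add: ctrans_def outer_def vec_eq_iff mult.commute)

lemma mult_outer: "M ** outer x y = outer (M *v x) y"
  by (simp add: outer_def matrix_matrix_mult_def matrix_vector_mult_def vec_eq_iff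
      sum_distrib_right mult.assoc)

lemma outer_mult: "outer x y ** M = outer x (ctrans M *v y)"
  by (simp add: outer_def ctrans_def matrix_matrix_mult_def matrix_vector_mult_def vec_eq_iff
      sum_distrib_left mult_ac)

lemma outer_diff_left: "outer (x - y) z = outer x z - outer y z"
  by (simp add: outer_def vec_eq_iff algebra_simps)

lemma outer_diff_right: "outer x (y - z) = outer x y - outer x z"
  by (simp add: outer_def vec_eq_iff algebra_simps)

lemma diag_outer_self: "diag_vec (outer x x) $ p = of_real ((cmod (x $ p))\<^sup>2)"
  by (simp only: diag_vec_def outer_def vec_lambda_beta complex_norm_square)

lemma trace_outer_self: "trace (outer x x) = of_real (\<Sum>p\<in>UNIV. (cmod (x $ p))\<^sup>2)"
  by (simp only: trace_def outer_def vec_lambda_beta complex_norm_square[symmetric] of_real_sum)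

lemma matrix_inv_mult:
  fixes M :: "'a::field^'n^'n"
  assumes "invertible M"
  shows "matrix_inv M ** M = mat 1" "M ** matrix_inv M = mat 1"
proof -
  have "M ** matrix_inv M = mat 1 \<and> matrix_inv M ** M = mat 1"
    using assms unfolding invertible_def matrix_inv_def by (rule someI_ex)
  then show "matrix_inv M ** M = mat 1" "M ** matrix_inv M = mat 1" by auto
qed

lemma matrix_inv_mult_vec:
  fixes M :: "'a::field^'n^'n"
  assumes "invertible M"
  shows "matrix_inv M *v (M *v x) = x" "M *v (matrix_inv M *v x) = x"
  by (simp_all add: matrix_vector_mul_assoc matrix_inv_mult[OF assms])

lemma invertible_ctrans:
  fixes M :: "complex^'n^'n"
  assumes "invertible M"
  shows "invertible (ctrans M)"
  using matrix_inv_mult[OF assms] unfolding invertible_def by (metis ctrans_mult ctrans_mat_1)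

lemma invertible_iff_ker:
  fixes M :: "'a::field^'n^'n"
  shows "invertible M \<longleftrightarrow> (\<forall>x. M *v x = 0 \<longrightarrow> x = 0)"
  by (simp add: invertible_left_inverse matrix_left_invertible_ker)

lemma diag_mat_mult_vec: "(diag_mat d *v x) $ p = d $ p * x $ p"
proof -
  have "(\<Sum>j\<in>UNIV. (if p = j then d $ p else 0) * x $ j) = (\<Sum>j\<in>UNIV. if p = j then d $ p * x $ j else 0)"
    by (rule sum.cong) auto
  then show ?thesis
    by (simp add: diag_mat_def matrix_vector_mult_def)
qed

lemma invertible_diag_mat:
  assumes "\<And>p. d $ p \<noteq> 0"
  shows "invertible (diag_mat d)"
  unfolding invertible_iff_ker using assms by (simp add: vec_eq_iff diag_mat_mult_vec)

section \<open>Rank-one block matrices\<close>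

text \<open>The rows span a one-dimensional space, so row \<open>i\<close> is \<open>c i\<close>
  times a common vector \<open>b\<close>, and both products equal
  \<open>c i * c k * b $ j * b $ l\<close>.\<close>

lemma rank_one_minor:
  fixes X :: "'a::field^'n^'m"
  assumes "rank X = 1"
  shows "X $ i $ j * X $ k $ l = X $ i $ l * X $ k $ j"
proof -
  obtain B where B: "rows X \<subseteq> vec.span B" "card B = vec.dim (rows X)"
    using vec.basis_exists by metis
  with assms obtain b where "B = {b}"
    by (auto simp: row_rank_def_gen card_1_singleton_iff)
  with B(1) have "\<exists>c. X $ i = c *s b" for i
    by (auto simp: vec.span_singleton rows_def row_def)
  then obtain c where "\<And>i. X $ i = c i *s b"
    by metis
  then show ?thesis
    by (simp add: mult_ac)
qed

text \<open>A single minor through the diagonal entry at \<open>Inl j\<close> would determine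
  \<open>S\<close> and \<open>T\<close> only where \<open>x $ j\<close> is nonzero. Summing these
  minors over \<open>j\<close> replaces that entry by the trace, which is nonzero as a
  whole.\<close>

lemma rank_one_block_recovery:
  fixes x :: "complex^'n" and S :: "complex^'l^'n"
  assumes rank: "rank (block_mat (outer x x) S (ctrans S) T) = 1"
    and tr: "trace (outer x x) \<noteq> 0"
    and y: "y = (1 / trace (outer x x)) *s (ctrans S *v x)"
  shows "outer x y = S" "outer y y = T"
proof -
  define t where "t = trace (outer x x)"
  have t: "t = (\<Sum>j\<in>UNIV. x $ j * cnj (x $ j))" "cnj t = t" "t \<noteq> 0"
    using tr by (simp_all add: t_def trace_def outer_def mult.commute)
  have y_t: "y $ k * t = (\<Sum>j\<in>UNIV. cnj (S $ j $ k) * x $ j)" for k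
    using t(3) by (simp add: y flip: t_def) (simp add: ctrans_def matrix_vector_mult_def)
  \<comment> \<open>The trace \<open>t\<close> is real, so conjugating \<open>y_t\<close> keeps the
    factor \<open>t\<close>.\<close>
  have cnj_y_t: "cnj (y $ k) * t = (\<Sum>j\<in>UNIV. S $ j $ k * cnj (x $ j))" for k
    using arg_cong[OF y_t[of k], of cnj] t(2) by simp
  note minor = rank_one_minor[OF rank]
  have S_minor: "S $ j $ k * (x $ p * cnj (x $ j)) = S $ p $ k * (x $ j * cnj (x $ j))" for j k p
    using minor[of "Inl j" "Inr k" "Inl p" "Inl j"]
    by (simp add: block_mat_def outer_def mult_ac)
  have T_minor: "cnj (S $ j $ k) * S $ j $ l = T $ k $ l * (x $ j * cnj (x $ j))" for j k l
    using minor[of "Inr k" "Inl j" "Inl j" "Inr l"]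
    by (simp add: block_mat_def outer_def ctrans_def)
  have xy: "x $ p * cnj (y $ k) = S $ p $ k" for p k
  proof -
    have "x $ p * cnj (y $ k) * t = (\<Sum>j\<in>UNIV. S $ j $ k * (x $ p * cnj (x $ j)))"
      unfolding mult.assoc cnj_y_t sum_distrib_left by (simp add: mult_ac)
    also have "\<dots> = S $ p $ k * t"
      unfolding t(1) sum_distrib_left by (rule sum.cong[OF refl S_minor])
    finally show ?thesis
      using t(3) by simp
  qed
  then show "outer x y = S"
    by (simp add: outer_def vec_eq_iff)
  have "y $ k * cnj (y $ l) = T $ k $ l" for k l
  proof -
    have "y $ k * t * cnj (y $ l) = (\<Sum>j\<in>UNIV. cnj (S $ j $ k) * (x $ j * cnj (y $ l)))"
      unfolding y_t sum_distrib_right by (simp add: mult_ac)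
    also have "\<dots> = T $ k $ l * t"
      by (simp only: xy T_minor t(1) sum_distrib_left)
    finally show ?thesis
      using t(3) by simp
  qed
  then show "outer y y = T"
    by (simp add: outer_def vec_eq_iff)
qed

section \<open>Invertibility of the voltage gain matrices\<close>

lemma phase_sum: "(\<Sum>p\<in>UNIV. f p) = f PhA + f PhB + f PhC" for f :: "phase \<Rightarrow> 'a::comm_monoid_add"
  by (simp add: UNIV_phase add.assoc)

lemma forall_phase: "(\<forall>p. P p) \<longleftrightarrow> P PhA \<and> P PhB \<and> P PhC"
  by (metis phase.exhaust)

text \<open>A closed-delta gain has determinant
  \<open>a * b * c + (1 - a) * (1 - b) * (1 - c)\<close>; with ratios in [0.9, 1.1] the first
  product is at least 0.729 and the second at most 0.001 in modulus. The other two types only need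
  nonzero ratios: one matrix is diagonal, and in the other the row of phase b decouples.\<close>

lemma invertible_gain:
  assumes r: "\<And>p. 0.9 \<le> r $ p \<and> r $ p \<le> 1.1"
  shows "invertible (gain k r)"
proof (cases k)
  case Wye
  have "r $ p \<noteq> 0" for p
    using r[of p] by auto
  then show ?thesis
    unfolding Wye gain.simps by (intro invertible_diag_mat) simp
next
  case Closed_Delta
  define a b c where "a = r $ PhA" and "b = r $ PhB" and "c = r $ PhC"
  have bnd: "0.9 \<le> a" "a \<le> 1.1" "0.9 \<le> b" "b \<le> 1.1" "0.9 \<le> c" "c \<le> 1.1"
    using r by (simp_all add: a_def b_def c_def)
  have "\<bar>1 - a\<bar> \<le> 0.1" "\<bar>1 - b\<bar> \<le> 0.1" "\<bar>1 - c\<bar> \<le> 0.1"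
    using bnd by (simp_all only: abs_le_iff) (simp_all add: field_simps)
  then have "\<bar>(1 - a) * (1 - b) * (1 - c)\<bar> \<le> 0.1 * 0.1 * 0.1"
    unfolding abs_mult by (intro mult_mono mult_nonneg_nonneg abs_ge_zero) simp_all
  moreover have "0.9 * 0.9 * 0.9 \<le> a * b * c"
    using bnd by (intro mult_mono) auto
  ultimately have "a * b * c + (1 - a) * (1 - b) * (1 - c) \<noteq> 0"
    by (auto simp: abs_if split: if_splits)
  then have "complex_of_real (a * b * c + (1 - a) * (1 - b) * (1 - c)) \<noteq> 0"
    by (simp only: of_real_eq_0_iff not_False_eq_True)
  then have det: "of_real a * of_real b * of_real c
      + (1 - of_real a) * (1 - of_real b) * (1 - of_real c) \<noteq> (0::complex)"
    by simp
  have cramer: "x = 0 \<and> y = 0 \<and> z = 0"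
    if eqs: "p * x + (1 - p) * y = 0" "q * y + (1 - q) * z = 0" "(1 - u) * x + u * z = 0"
      and det: "p * q * u + (1 - p) * (1 - q) * (1 - u) \<noteq> 0" (is "?d \<noteq> 0")
    for p q u x y z :: complex
  proof -
    \<comment> \<open>The multipliers of the three equations are the rows of the adjugate matrix,
      and \<open>?d\<close> is the determinant.\<close>
    have "?d * x = q * u * (p * x + (1 - p) * y) - u * (1 - p) * (q * y + (1 - q) * z)
        + (1 - p) * (1 - q) * ((1 - u) * x + u * z)"
      "?d * y = u * p * (q * y + (1 - q) * z) - p * (1 - q) * ((1 - u) * x + u * z)
        + (1 - q) * (1 - u) * (p * x + (1 - p) * y)"
      "?d * z = p * q * ((1 - u) * x + u * z) - q * (1 - u) * (p * x + (1 - p) * y)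
        + (1 - u) * (1 - p) * (q * y + (1 - q) * z)"
      by (simp_all add: algebra_simps)
    then have "?d * x = 0" "?d * y = 0" "?d * z = 0"
      by (simp_all only: eqs mult_zero_right diff_zero add_0_left)
    with det show ?thesis by simp
  qed
  show ?thesis
    unfolding invertible_iff_ker Closed_Delta
    by (simp add: vec_eq_iff forall_phase matrix_vector_mult_def phase_sum phase_vec_def Let_def
        flip: a_def b_def c_def) (use cramer[OF _ _ _ det] in blast)
next
  case Open_Delta
  have "r $ PhA \<noteq> 0" "r $ PhC \<noteq> 0"
    using r[of PhA] r[of PhC] by auto
  then show ?thesis
    unfolding invertible_iff_ker Open_Delta
    by (auto simp: vec_eq_iff forall_phase matrix_vector_mult_def phase_sum phase_vec_def Let_def)
qed

section \<open>The loop invariant\<close>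

text \<open>Besides the BOPF equations of the edge, the \<open>outer\<close> identities are kept
  because they match the summands of the power balance in BOPF with those in RBOPF. Only the end
  points and the edge itself occur, so assignments elsewhere preserve the property.\<close>

definition edge_retrieved ::
  "network \<Rightarrow> (nat \<times> nat \<Rightarrow> cmat) \<Rightarrow> (nat \<times> nat \<Rightarrow> cmat) \<Rightarrow> (nat \<times> nat \<Rightarrow> cmat) \<Rightarrow>
   (nat \<times> nat \<Rightarrow> cmat) \<Rightarrow> (nat \<Rightarrow> cvec) \<Rightarrow> (nat \<times> nat \<Rightarrow> cvec) \<Rightarrow> (nat \<times> nat \<Rightarrow> cvec) \<Rightarrow>
   nat \<times> nat \<Rightarrow> bool" where
  "edge_retrieved net I S S' A v i i' = (\<lambda>(n, m).
     outer (v n) (i (n, m)) = S (n, m) \<and>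
     ((n, m) \<in> svrs net \<longrightarrow>
        v n = A (n, m) *v v m \<and>
        i (n, m) = matrix_inv (ctrans (A (n, m))) *v i' (n, m) \<and>
        diag_vec (outer (v m) (i' (n, m))) = diag_vec (S' (n, m))) \<and>
     ((n, m) \<in> lines net \<longrightarrow>
        v m = v n - impedance net (n, m) *v i (n, m) \<and>
        outer (v m) (i (n, m)) = S (n, m) - impedance net (n, m) ** I (n, m)))"

text \<open>\<open>U\<close> is the set of edges traversed so far.\<close>

definition retrieval_inv ::
  "network \<Rightarrow> (nat \<Rightarrow> cmat) \<Rightarrow> (nat \<times> nat \<Rightarrow> cmat) \<Rightarrow> (nat \<times> nat \<Rightarrow> cmat) \<Rightarrow>
   (nat \<times> nat \<Rightarrow> cmat) \<Rightarrow> (nat \<times> nat \<Rightarrow> cmat) \<Rightarrow> retrieval_state \<Rightarrow> bool" where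
  "retrieval_inv net V I S S' A = (\<lambda>(W, v, i, i').
     0 \<in> W \<and> W \<subseteq> buses net \<and> v 0 = slack net \<and> (\<forall>m\<in>W. V m = outer (v m) (v m)) \<and>
     (\<exists>U \<subseteq> edges net \<inter> W \<times> W. graph_connected W U \<and>
        (\<forall>e\<in>U. edge_retrieved net I S S' A v i i' e)))"

lemma graph_connected_insert:
  assumes "graph_connected W U" "n \<in> W"
  shows "graph_connected (insert m W) (insert (n, m) U)"
proof -
  let ?R = "insert (n, m) U \<union> (insert (n, m) U)\<inverse>"
  have "(u, w) \<in> ?R\<^sup>*" if "u \<in> W" "w \<in> W" for u w
    using assms that rtrancl_mono[of "U \<union> U\<inverse>" ?R] by (auto simp: graph_connected_def)
  moreover have "(n, m) \<in> ?R" "(m, n) \<in> ?R"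
    by auto
  ultimately show ?thesis
    using assms(2) unfolding graph_connected_def
    by (metis converse_rtrancl_into_rtrancl insert_iff rtrancl.simps)
qed

text \<open>This is the part common to both kinds of loop pass: \<open>j\<close> stands for
  \<open>i'\<close>, either updated at \<open>(n, m)\<close> or left alone. Since \<open>m\<close>
  was unvisited, no edge of \<open>U\<close> touches it, and what was known about \<open>U\<close>
  survives the updates.\<close>

lemma retrieval_inv_extend:
  assumes wf: "wf_network net"
    and inv: "retrieval_inv net V I S S' A (W, v, i, i')"
    and e: "(n, m) \<in> edges net" "n \<in> W" "m \<notin> W"
    and V: "V m = outer vm vm"
    and edge: "edge_retrieved net I S S' A (v(m := vm)) (i((n, m) := inm)) j (n, m)"
    and j: "\<And>e. snd e \<noteq> m \<Longrightarrow> j e = i' e"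
  shows "retrieval_inv net V I S S' A (insert m W, v(m := vm), i((n, m) := inm), j)"
proof -
  from inv obtain U where U: "U \<subseteq> edges net \<inter> W \<times> W" "graph_connected W U"
    "\<And>e. e \<in> U \<Longrightarrow> edge_retrieved net I S S' A v i i' e"
    by (auto simp: retrieval_inv_def)
  have "edge_retrieved net I S S' A (v(m := vm)) (i((n, m) := inm)) j e" if "e \<in> U" for e
  proof -
    obtain p q where pq: "e = (p, q)" by force
    with that U(1) e have "p \<noteq> m" "q \<noteq> m" by auto
    moreover from this have "j (p, q) = i' (p, q)" by (intro j) simp
    ultimately have "edge_retrieved net I S S' A (v(m := vm)) (i((n, m) := inm)) j e
        = edge_retrieved net I S S' A v i i' e"
      unfolding pq by (simp add: edge_retrieved_def)
    with U(3)[OF that] show ?thesis by simp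
  qed
  moreover have "m \<in> buses net"
    using wf e by (auto simp: wf_network_def)
  moreover have "insert (n, m) U \<subseteq> edges net \<inter> insert m W \<times> insert m W"
    using U(1) e by auto
  moreover have "graph_connected (insert m W) (insert (n, m) U)"
    using U(2) e(2) by (rule graph_connected_insert)
  ultimately show ?thesis
    using inv e V edge unfolding retrieval_inv_def prod.case
    by (intro conjI exI[of _ "insert (n, m) U"]) auto
qed

section \<open>Invariance along runs, and feasibility of the output\<close>

context
  fixes net s sinj V I S S' r A
  assumes wf: "wf_network net"
    and radial: "radial net"
    and feas: "rbopf_feasible net s sinj V I S S' r A"
begin

lemma edge_rank:
  assumes "(n, m) \<in> edges net"
  shows "rank (block_mat (V n) (S (n, m)) (ctrans (S (n, m))) (I (n, m))) = 1"
  using feas assms unfolding rbopf_feasible_def Let_def by blast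

text \<open>Multiplying \<open>V n = A ** V m ** ctrans A\<close> by the inverses on both sides
  carries the rank-one form over to the secondary. The vector \<open>x\<close> is independent of any
  run, so the lemma also applies before the pass is known to be executable.\<close>

lemma svr_voltage:
  assumes "(n, m) \<in> svrs net" "invertible (A (n, m))" "V n = outer x x"
  shows "V m = outer (matrix_inv (A (n, m)) *v x) (matrix_inv (A (n, m)) *v x)"
proof -
  let ?A = "A (n, m)"
  have V: "V n = ?A ** V m ** ctrans ?A"
    using feas assms(1) unfolding rbopf_feasible_def by auto
  note inv_A = matrix_inv_mult[OF assms(2)]
  have inv_A': "ctrans ?A ** ctrans (matrix_inv ?A) = mat 1"
    by (simp add: inv_A flip: ctrans_mult)
  have "outer (matrix_inv ?A *v x) (matrix_inv ?A *v x)
      = matrix_inv ?A ** V n ** ctrans (matrix_inv ?A)"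
    by (simp add: assms(3) mult_outer outer_mult)
  also have "\<dots> = (matrix_inv ?A ** ?A) ** V m ** (ctrans ?A ** ctrans (matrix_inv ?A))"
    unfolding V by (simp only: matrix_mul_assoc)
  also have "\<dots> = V m"
    by (simp add: inv_A inv_A')
  finally show ?thesis ..
qed

lemma retrieval_inv_step:
  assumes "retrieval_step net V S S' A \<sigma> \<tau>" "retrieval_inv net V I S S' A \<sigma>"
  shows "retrieval_inv net V I S S' A \<tau>"
  using assms
proof cases
  case (svr W n m inm v vm inm' i i')
  let ?A = "A (n, m)"
  have inv: "retrieval_inv net V I S S' A (W, v, i, i')"
    using assms(2) svr(1) by simp
  then have Vn: "V n = outer (v n) (v n)"
    using svr(5) by (auto simp: retrieval_inv_def)
  have rec: "outer (v n) inm = S (n, m)"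
    using rank_one_block_recovery(1) edge_rank svr Vn by metis
  have feas_e: "diag_vec (matrix_inv ?A ** S (n, m) ** ?A) = diag_vec (S' (n, m))"
    using feas svr(7) unfolding rbopf_feasible_def by auto
  have Vm: "V m = outer vm vm"
    using svr_voltage[OF svr(7) svr(10) Vn] by (simp add: svr(11))
  \<comment> \<open>With \<open>S (n, m)\<close> written as an outer product,
    \<open>matrix_inv ?A\<close> acts on the left factor and gives \<open>vm\<close>, while
    \<open>?A\<close> moves to the right factor as \<open>ctrans ?A\<close>.\<close>
  have S': "diag_vec (S' (n, m)) = diag_vec (outer vm (ctrans ?A *v inm))"
    unfolding feas_e[symmetric] by (simp add: svr(11) mult_outer outer_mult flip: rec)
  \<comment> \<open>Conjugating the diagonal entries shows that \<open>ctrans ?A *v inm\<close>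
    solves the diagonal system whose solution the algorithm assigns to \<open>inm'\<close>; hence
    the two agree.\<close>
  have "diag_vec (ctrans (S' (n, m))) = diag_mat (cnj_vec vm) *v (ctrans ?A *v inm)"
  proof -
    have "S' (n, m) $ p $ p = vm $ p * cnj ((ctrans ?A *v inm) $ p)" for p
      using arg_cong[OF S', of "\<lambda>x. x $ p"] by (simp add: diag_vec_def outer_def)
    then show ?thesis
      by (simp add: vec_eq_iff diag_mat_mult_vec cnj_vec_def) (simp add: diag_vec_def ctrans_def)
  qed
  then have inm': "inm' = ctrans ?A *v inm"
    by (simp add: svr(13) matrix_inv_mult_vec(1)[OF svr(12)] del: matrix_vector_mul_assoc)
  have "?A *v vm = v n"
    by (simp add: svr(11) matrix_inv_mult_vec(2)[OF svr(10)] del: matrix_vector_mul_assoc)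
  moreover have "matrix_inv (ctrans ?A) *v inm' = inm"
    by (simp add: inm' matrix_inv_mult_vec(1) invertible_ctrans svr(10) del: matrix_vector_mul_assoc)
  \<comment> \<open>Disjointness makes the clauses for lines vacuous, and
    \<open>n \<noteq> m\<close> ensures that updating \<open>v\<close> at \<open>m\<close> leaves
    \<open>v n\<close> unchanged.\<close>
  moreover have "(n, m) \<notin> lines net"
    using wf svr(7) by (auto simp: wf_network_def)
  moreover have "n \<noteq> m"
    using svr by auto
  ultimately have edge: "edge_retrieved net I S S' A
      (v(m := vm)) (i((n, m) := inm)) (i'((n, m) := inm')) (n, m)"
    using rec S' by (simp add: edge_retrieved_def inm')
  show ?thesis
    unfolding svr(2)
    by (rule retrieval_inv_extend[OF wf inv svr(4-6) Vm edge]) auto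
next
  case (line W n m inm v vm i i')
  let ?Z = "impedance net (n, m)"
  have inv: "retrieval_inv net V I S S' A (W, v, i, i')"
    using assms(2) line(1) by simp
  then have Vn: "V n = outer (v n) (v n)"
    using line(5) by (auto simp: retrieval_inv_def)
  have rec: "outer (v n) inm = S (n, m)" "outer inm inm = I (n, m)"
    using rank_one_block_recovery edge_rank line Vn by metis+
  have "(n, m) \<in> lines net"
    using line by (auto simp: edges_def)
  then have "V m = V n + ?Z ** I (n, m) ** ctrans ?Z
      - (S (n, m) ** ctrans ?Z + ?Z ** ctrans (S (n, m)))"
    using feas unfolding rbopf_feasible_def Let_def by auto
  \<comment> \<open>After \<open>S\<close> and \<open>I\<close> are replaced by outer products, this
    is the expansion of the outer product of \<open>v n - ?Z *v inm\<close> with itself.\<close>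
  also have "\<dots> = outer vm vm"
    by (simp add: line(10) Vn mult_outer outer_mult ctrans_outer outer_diff_left outer_diff_right
        flip: rec)
  finally have Vm: "V m = outer vm vm" .
  have "outer vm inm = S (n, m) - ?Z ** I (n, m)"
    by (simp add: line(10) outer_diff_left mult_outer flip: rec)
  moreover have "n \<noteq> m"
    using line by auto
  ultimately have edge: "edge_retrieved net I S S' A (v(m := vm)) (i((n, m) := inm)) i' (n, m)"
    using rec(1) line(7,10) by (simp add: edge_retrieved_def)
  show ?thesis
    unfolding line(2)
    by (rule retrieval_inv_extend[OF wf inv line(4-6) Vm edge]) auto
qed

lemma retrieval_inv_run:
  assumes "retrieval_run net V S S' A \<sigma>"
  shows "retrieval_inv net V I S S' A \<sigma>"
proof -
  obtain v i i' where v: "v 0 = slack net"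
    and run: "(retrieval_step net V S S' A)\<^sup>*\<^sup>* ({0}, v, i, i') \<sigma>"
    using assms unfolding retrieval_run_def by blast
  have "V 0 = outer (v 0) (v 0)"
    using feas v unfolding rbopf_feasible_def by simp
  \<comment> \<open>The invariant starts with no traversed edge: a single bus is connected.\<close>
  with v have "retrieval_inv net V I S S' A ({0}, v, i, i')"
    unfolding retrieval_inv_def prod.case
    by (intro conjI exI[of _ "{}"]) (auto simp: buses_def graph_connected_def)
  with run show ?thesis
    by induction (blast intro: retrieval_inv_step)+
qed

text \<open>Once all buses are visited, the edge equations hold on all of \<open>edges net\<close>,
  and the sums of the power balance agree term by term with those of RBOPF.\<close>

lemma bopf_feasible_retrieval_output:
  assumes "retrieval_output net V S S' A v i i'"
  shows "bopf_feasible net s sinj v i i' r A"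
proof -
  have inv: "retrieval_inv net V I S S' A (buses net, v, i, i')"
    using assms retrieval_inv_run unfolding retrieval_output_def by blast
  then have v0: "v 0 = slack net" and V: "\<And>m. m \<in> buses net \<Longrightarrow> V m = outer (v m) (v m)"
    by (auto simp: retrieval_inv_def)
  from inv obtain U where U: "U \<subseteq> edges net" "graph_connected (buses net) U"
    "\<forall>e\<in>U. edge_retrieved net I S S' A v i i' e"
    by (auto simp: retrieval_inv_def)
  \<comment> \<open>Radiality enters here: the traversed edges connect all buses, so no edge of the
    tree is left over.\<close>
  have "U = edges net"
    using wf radial U by (intro graph_tree_spanning_subgraph) (auto simp: wf_network_def radial_def)
  with U(3) have edge: "\<And>e. e \<in> edges net \<Longrightarrow> edge_retrieved net I S S' A v i i' e"
    by blast
  have sv: "v n = A (n, m) *v v m" "i (n, m) = matrix_inv (ctrans (A (n, m))) *v i' (n, m)"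
    "diag_vec (outer (v m) (i' (n, m))) = diag_vec (S' (n, m))" if "(n, m) \<in> svrs net" for n m
    using edge[of "(n, m)"] that by (auto simp only: edge_retrieved_def edges_def prod.case Un_iff)
  have ln: "v m = v n - impedance net (n, m) *v i (n, m)"
    "outer (v m) (i (n, m)) = S (n, m) - impedance net (n, m) ** I (n, m)"
    if "(n, m) \<in> lines net" for n m
    using edge[of "(n, m)"] that by (auto simp only: edge_retrieved_def edges_def prod.case Un_iff)
  have out: "outer (v n) (i (n, m)) = S (n, m)" if "(n, m) \<in> edges net" for n m
    using edge[OF that] by (simp only: edge_retrieved_def prod.case)
  have balance: "s m =
        (\<Sum>k | (m, k) \<in> edges net. diag_vec (outer (v m) (i (m, k))))
        - (\<Sum>n | (n, m) \<in> edges net \<and> n \<in> primaries net m. diag_vec (outer (v m) (i' (n, m))))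
        - (\<Sum>n | (n, m) \<in> edges net \<and> n \<notin> primaries net m. diag_vec (outer (v m) (i (n, m))))"
    if "m \<in> buses net" for m
  proof -
    have "(\<Sum>k | (m, k) \<in> edges net. diag_vec (outer (v m) (i (m, k))))
        = (\<Sum>k | (m, k) \<in> edges net. diag_vec (S (m, k)))"
      by (intro sum.cong) (auto simp: out)
    moreover have "(\<Sum>n | (n, m) \<in> edges net \<and> n \<in> primaries net m. diag_vec (outer (v m) (i' (n, m))))
        = (\<Sum>n | (n, m) \<in> edges net \<and> n \<in> primaries net m. diag_vec (S' (n, m)))"
      by (intro sum.cong) (auto simp: sv(3) primaries_def)
    moreover have "(\<Sum>n | (n, m) \<in> edges net \<and> n \<notin> primaries net m. diag_vec (outer (v m) (i (n, m))))
        = (\<Sum>n | (n, m) \<in> edges net \<and> n \<notin> primaries net m.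
             diag_vec (S (n, m) - impedance net (n, m) ** I (n, m)))"
      by (intro sum.cong) (auto simp: ln(2) primaries_def edges_def)
    moreover have "s m = (\<Sum>k | (m, k) \<in> edges net. diag_vec (S (m, k)))
        - (\<Sum>n | (n, m) \<in> edges net \<and> n \<in> primaries net m. diag_vec (S' (n, m)))
        - (\<Sum>n | (n, m) \<in> edges net \<and> n \<notin> primaries net m.
             diag_vec (S (n, m) - impedance net (n, m) ** I (n, m)))"
      using feas that unfolding rbopf_feasible_def by blast
    ultimately show ?thesis by (simp only:)
  qed
  have limits: "vmin net $ p \<le> cmod (v n $ p) \<and> cmod (v n $ p) \<le> vmax net $ p"
    if "n \<in> buses net" for n p
  proof -
    have "(vmin net $ p)\<^sup>2 \<le> Re (diag_vec (V n) $ p) \<and> Re (diag_vec (V n) $ p) \<le> (vmax net $ p)\<^sup>2"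
      using feas that unfolding rbopf_feasible_def by blast
    then have "(vmin net $ p)\<^sup>2 \<le> (cmod (v n $ p))\<^sup>2 \<and> (cmod (v n $ p))\<^sup>2 \<le> (vmax net $ p)\<^sup>2"
      by (simp only: V[OF that] diag_outer_self Re_complex_of_real)
    \<comment> \<open>Removing the squares from an inequality requires a nonnegative larger side:
      \<open>vmax\<close> for the upper limit, the modulus for the lower one.\<close>
    moreover have "0 \<le> vmax net $ p"
      using wf by (simp add: wf_network_def)
    ultimately show ?thesis
      by (auto intro: power2_le_imp_le)
  qed
  show ?thesis
    unfolding bopf_feasible_def
  proof (intro conjI)
    show "\<forall>m\<in>buses net. s m = sinj m - diag_vec (outer (v m) (v m) ** ctrans (shunt net m))"
      using feas unfolding rbopf_feasible_def by (metis V)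
    show "\<forall>(n, m)\<in>svrs net. v n = A (n, m) *v v m \<and>
        i (n, m) = matrix_inv (ctrans (A (n, m))) *v i' (n, m)"
      using sv by blast
    show "\<forall>(n, m)\<in>lines net. v m = v n - impedance net (n, m) *v i (n, m)"
      using ln by blast
    show "svr_constraints net r A" "\<exists>t\<in>injections net. \<forall>m\<in>buses net. t m = sinj m"
      using feas unfolding rbopf_feasible_def by blast+
  qed (use balance limits v0 in blast)+
qed

section \<open>Progress and termination of the algorithm\<close>

text \<open>Nonzero entries are what the division by the trace and the inversion of
  \<open>diag_mat\<close> rely on.\<close>

lemma voltage_nonzero:
  assumes "\<forall>p. 0 < vmin net $ p" "n \<in> buses net" "V n = outer x x"
  shows "x $ p \<noteq> 0"
proof -
  have "(vmin net $ p)\<^sup>2 \<le> Re (diag_vec (V n) $ p)"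
    using feas assms(2) unfolding rbopf_feasible_def by blast
  then have "(vmin net $ p)\<^sup>2 \<le> (cmod (x $ p))\<^sup>2"
    by (simp only: assms(3) diag_outer_self Re_complex_of_real)
  moreover have "0 < (vmin net $ p)\<^sup>2"
    using assms(1) by (intro zero_less_power) blast
  ultimately show ?thesis
    by auto
qed

text \<open>If no edge left \<open>W\<close>, then \<open>W\<close> would contain everything
  reachable from bus 0, that is, every bus. For an edge leaving \<open>W\<close>, the trace is a sum
  of positive squares and the required inverses exist, so the pass can be executed.\<close>

lemma retrieval_step_progress:
  assumes outward: "outward net" and vmin: "\<forall>p. 0 < vmin net $ p"
    and inv: "retrieval_inv net V I S S' A (W, v, i, i')" and "W \<noteq> buses net"
  shows "\<exists>\<tau>. retrieval_step net V S S' A (W, v, i, i') \<tau> \<and> W \<subset> fst \<tau>"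
proof -
  from inv have W: "0 \<in> W" "W \<subseteq> buses net" "\<And>m. m \<in> W \<Longrightarrow> V m = outer (v m) (v m)"
    by (auto simp: retrieval_inv_def)
  with \<open>W \<noteq> buses net\<close> obtain t where "t \<in> buses net" "t \<notin> W"
    by blast
  have "\<exists>n m. (n, m) \<in> edges net \<and> n \<in> W \<and> m \<notin> W"
  proof (rule ccontr)
    assume closed: "\<not> ?thesis"
    have "t \<in> W" if "(0, t) \<in> (edges net)\<^sup>*" for t
      using that W(1) closed by (induction rule: rtrancl_induct) auto
    with outward \<open>t \<in> buses net\<close> \<open>t \<notin> W\<close> show False
      by (auto simp: outward_def)
  qed
  then obtain n m where nm: "(n, m) \<in> edges net" "n \<in> W" "m \<notin> W"
    by blast
  then have buses: "n \<in> buses net" "m \<in> buses net"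
    using wf by (auto simp: wf_network_def)
  have "0 < (\<Sum>p\<in>UNIV. (cmod (v n $ p))\<^sup>2)"
    using voltage_nonzero[OF vmin buses(1) W(3)[OF nm(2)]] by (intro sum_pos) auto
  then have tr: "trace (V n) \<noteq> 0"
    by (simp only: W(3)[OF nm(2)] trace_outer_self of_real_eq_0_iff)
  have W_less: "W \<subset> insert m W"
    using nm(3) by blast
  show ?thesis
  proof (cases "(n, m) \<in> svrs net")
    case False
    show ?thesis
      by (intro exI conjI, rule retrieval_step.line)
        (rule assms(4) nm False tr refl | simp add: W_less)+
  next
    case True
    have "svr_constraints net r A"
      using feas by (simp add: rbopf_feasible_def)
    with True have inv_A: "invertible (A (n, m))"
      unfolding svr_constraints_def by (metis invertible_gain)
    define vm where "vm = matrix_inv (A (n, m)) *v v n"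
    \<comment> \<open>The candidate \<open>vm\<close> already factors \<open>V m\<close> before it
      is assigned, so the magnitude limit at \<open>m\<close> keeps its entries away from
      zero.\<close>
    have "V m = outer vm vm"
      unfolding vm_def by (rule svr_voltage[OF True inv_A W(3)[OF nm(2)]])
    then have "vm $ p \<noteq> 0" for p
      using voltage_nonzero vmin buses by blast
    then have inv_v: "invertible (diag_mat (cnj_vec vm))"
      by (intro invertible_diag_mat) (simp add: cnj_vec_def)
    show ?thesis
      by (intro exI conjI, rule retrieval_step.svr)
        (rule assms(4) nm True tr inv_A vm_def inv_v refl | simp add: W_less)+
  qed
qed

text \<open>The number of unvisited buses decreases with every pass. Starting from any state with
  the invariant allows arbitrary earlier choices of edges.\<close>

lemma retrieval_run_completes:
  assumes "outward net" "\<forall>p. 0 < vmin net $ p" "retrieval_inv net V I S S' A \<sigma>"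
  shows "\<exists>\<tau>. (retrieval_step net V S S' A)\<^sup>*\<^sup>* \<sigma> \<tau> \<and> fst \<tau> = buses net"
  using assms(3)
proof (induction "card (buses net - fst \<sigma>)" arbitrary: \<sigma> rule: less_induct)
  case less
  show ?case
  proof (cases "fst \<sigma> = buses net")
    case True
    then show ?thesis by blast
  next
    case False
    obtain W v i i' where \<sigma>: "\<sigma> = (W, v, i, i')"
      by (cases \<sigma>)
    have "retrieval_inv net V I S S' A (W, v, i, i')" "W \<noteq> buses net"
      using less.prems False by (simp_all add: \<sigma>)
    from retrieval_step_progress[OF assms(1,2) this]
    obtain \<tau> where \<tau>: "retrieval_step net V S S' A \<sigma> \<tau>" "fst \<sigma> \<subset> fst \<tau>"
      by (auto simp only: \<sigma> fst_conv)
    have inv: "retrieval_inv net V I S S' A \<tau>"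
      using \<tau>(1) less.prems by (rule retrieval_inv_step)
    then have "fst \<tau> \<subseteq> buses net"
      by (auto simp: retrieval_inv_def)
    with \<tau>(2) have "card (buses net - fst \<tau>) < card (buses net - fst \<sigma>)"
      by (intro psubset_card_mono) (auto simp: buses_def)
    from less.hyps[OF this inv] obtain \<rho>
      where \<rho>: "(retrieval_step net V S S' A)\<^sup>*\<^sup>* \<tau> \<rho>" "fst \<rho> = buses net"
      by blast
    from \<tau>(1) \<rho>(1) have "(retrieval_step net V S S' A)\<^sup>*\<^sup>* \<sigma> \<rho>"
      by (rule converse_rtranclp_into_rtranclp)
    with \<rho>(2) show ?thesis by blast
  qed
qed

end

text \<open>The first conjunct covers every order in which edges may be chosen. The second excludes
  getting stuck: with every bus reachable along edge directions and positive lower limits, each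
  partial run extends to a complete one, so the first conjunct is then not vacuous.\<close>

theorem proposition2:
  fixes net :: network
    and s sinj :: "nat \<Rightarrow> cvec"
    and V :: "nat \<Rightarrow> cmat"
    and I S S' A :: "nat \<times> nat \<Rightarrow> cmat"
    and r :: "nat \<times> nat \<Rightarrow> real ^ phase"
  assumes "wf_network net"
    and "radial net"
    and "rbopf_feasible net s sinj V I S S' r A"
  shows "(\<forall>v i i'. retrieval_output net V S S' A v i i' \<longrightarrow> bopf_feasible net s sinj v i i' r A) \<and>
    (outward net \<and> (\<forall>p. 0 < vmin net $ p) \<longrightarrow>
      (\<forall>\<sigma>. retrieval_run net V S S' A \<sigma> \<longrightarrow>
        (\<exists>v i i'. (retrieval_step net V S S' A)\<^sup>*\<^sup>* \<sigma> (buses net, v, i, i'))))"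
proof (intro conjI impI allI)
  fix v i i' assume "retrieval_output net V S S' A v i i'"
  with assms show "bopf_feasible net s sinj v i i' r A"
    by (rule bopf_feasible_retrieval_output)
next
  fix \<sigma> assume "outward net \<and> (\<forall>p. 0 < vmin net $ p)" "retrieval_run net V S S' A \<sigma>"
  with assms obtain \<tau> where "(retrieval_step net V S S' A)\<^sup>*\<^sup>* \<sigma> \<tau>" "fst \<tau> = buses net"
    using retrieval_run_completes retrieval_inv_run by metis
  then show "\<exists>v i i'. (retrieval_step net V S S' A)\<^sup>*\<^sup>* \<sigma> (buses net, v, i, i')"
    by (metis prod.collapse)
qed

end
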